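(* Suppose $\frac{h_1}{\mu_1}\ge\frac{h_2}{\mu_2}$. Consider decision states $(i,k,\ell)$, i.e. $(i,k,\ell)\in\mathbb{X}$ with $i\ge 1$ (so $k+\ell=C_1$). 1. Suppose $\mu_1\le\mu_2$. There exist finite thresholds $N_2(\ell)\in\mathbb{Z}_+$, depending on $\ell$ only (equivalently on $k=C_1-\ell$ only), for $C_2\le\ell\le C_1-1$, such that the following holds. (a) If a job at the independent station (Station 1) is completed first (so $k\ge1$): (i) if $\ell<C_2$, it is optimal to choose collaborative service next, for every $i\ge1$; (ii) if $\ell\ge C_2$, there is an optimal policy of collaborative threshold type with threshold $N_2(\ell)+1$, i.e. it is optimal to choose collaborative service if $i<N_2(\ell)+1$ and independent service otherwise; (iii) if $\ell\ge C_2$ and in addition $\frac{h_1}{\mu_1}\le\frac{\ell+1}{C_2}\frac{h_2}{\mu_2}$, it is optimal to choose independent service, for every $i\ge1$. (b) If a job at the collaborative station (Station 2) is completed first (so $\ell\ge1$): (i) if $\ell\le C_2$, it is optimal to choose collaborative service for every $i\ge1$; (ii) if $\ell>C_2$, there is an optimal policy of collaborative threshold type with finite threshold $N_2(\ell-1)+1$, i.e. it is optimal to choose collaborative service if $i<N_2(\ell-1)+1$ and independent service otherwise; (iii) if $\ell>C_2$ and in addition $\frac{h_1}{\mu_1}\le\frac{\ell}{C_2}\frac{h_2}{\mu_2}$, it is optimal to choose independent service for every $i\ge1$. 2. Suppose $\mu_1>\mu_2$. There exist finite thresholds $N_1(\ell)\in\mathbb{Z}_+$, depending on $\ell$ only,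 for $0\le\ell\le C_1-1$, such that the following holds. (a) If a job at Station 1 is completed first (so $k\ge1$): (i) there is an optimal policy of collaborative threshold type with finite threshold $N_1(\ell)+1$, i.e. it is optimal to choose collaborative service if $i<N_1(\ell)+1$ and independent service otherwise; (ii) if in addition $\frac{h_1}{\mu_1}\le\frac{\ell+1}{C_2}\frac{h_2}{\mu_2}$, it is optimal to choose independent service for every $i\ge1$. (b) If a job at Station 2 is completed first (so $\ell\ge1$): (i) there is an optimal policy of collaborative threshold type with finite threshold $N_1(\ell-1)+1$, i.e. it is optimal to choose collaborative service if $i<N_1(\ell-1)+1$ and independent service otherwise; (ii) if in addition $\frac{h_1}{\mu_1}\le\frac{\ell}{C_2}\frac{h_2}{\mu_2}$, it is optimal to choose independent service for every $i\ge1$.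
   Context: Let $C_1,C_2\ge1$ be integers with $C_2<C_1$ (numbers of Type-I and Type-II servers), $\mu_1,\mu_2>0$ (service rates at Station 1, the independent service station, and Station 2, the collaborative service station) and $h_0,h_1,h_2>0$ (holding costs per job per unit time in the initial queue, at Station 1 and at Station 2). Write $\mathbb{Z}_+=\{0,1,2,\dots\}$. The state space is $$\mathbb{X}=\{(i,k,\ell)\in\mathbb{Z}_+^3 : (i=0 \text{ and } k+\ell<C_1)\text{ or }(i\ge0\text{ and }k+\ell=C_1)\},$$ where $i$ is the number of jobs in the initial queue, $k$ the number of jobs in service at Station 1 and $\ell$ the number of jobs at Station 2 (in service or waiting there). There are no arrivals. Service is non-preemptive with exponential times: Station 1 completes services at total rate $k\mu_1$ and Station 2 at total rate $\min\{\ell,C_2\}\mu_2$; put $d(k,\ell)=k\mu_1+\min\{\ell,C_2\}\mu_2$. Decisions: in a state $(i,k,\ell)$ with $i\ge1$, when a service completes the freed Type-I server takes the next queued job and chooses independent service (Station 1) or collaborative service (Station 2). If a Station 1 job is completed first, the next state is $(i-1,k,\ell)$ under independent and $(i-1,k-1,\ell+1)$ under collaborative service. If a Station 2 job is completed first, the next state is $(i-1,k+1,\ell-1)$ under independent and $(i-1,k,\ell)$ under collaborative service. The value function $v:\mathbb{X}\to\mathbb{R}$ is the minimal expected total holding cost until the system is empty. It satisfies $v(0,0,0)=0$, $$v(0,k,\ell)=\tfrac{kh_1+\ell h_2}{d(k,\ell)}+\tfrac{k\mu_1}{d(k,\ell)}v(0,k-1,\ell)+\tfrac{\min\{\ell,C_2\}\mu_2}{d(k,\ell)}v(0,k,\ell-1)\quad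 ((k,\ell)\ne(0,0)),$$ and for $i\ge1$, $$v(i,k,\ell)=\tfrac{ih_0+kh_1+\ell h_2}{d(k,\ell)}+\tfrac{k\mu_1}{d(k,\ell)}\min\{v(i-1,k,\ell),v(i-1,k-1,\ell+1)\}+\tfrac{\min\{\ell,C_2\}\mu_2}{d(k,\ell)}\min\{v(i-1,k+1,\ell-1),v(i-1,k,\ell)\},$$ where terms with coefficient $0$ are read as $0$. A decision is optimal if the state it leads to attains the corresponding minimum; a policy is optimal if all of its decisions are. A policy is of collaborative threshold type with threshold $N$ if it chooses collaborative service when the number $i$ of jobs in queue is below $N$ and independent service otherwise. *)

theory Defs
  imports "HOL-Probability.Probability_Mass_Function"
begin

record station_model =
  C\<^sub>1 :: nat
  C\<^sub>2 :: nat
  \<mu>\<^sub>1 :: real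
  \<mu>\<^sub>2 :: real
  h\<^sub>0 :: real
  h\<^sub>1 :: real
  h\<^sub>2 :: real

text \<open>A state \<open>(i, k, l)\<close> has \<open>i\<close> jobs in the initial queue, \<open>k\<close> at Station 1 and \<open>l\<close> at Station 2.\<close>

type_synonym state = "nat \<times> nat \<times> nat"

definition state_space :: "station_model \<Rightarrow> state set" where
  "state_space M = {(i, k, l). (i = 0 \<and> k + l < C\<^sub>1 M) \<or> k + l = C\<^sub>1 M}"

definition decision_states :: "station_model \<Rightarrow> state set" where
  "decision_states M = {(i, k, l). (i, k, l) \<in> state_space M \<and> i \<ge> 1}"

datatype station = Station1 | Station2

datatype decision = Independent | Collaborative

fun total_rate :: "station_model \<Rightarrow> state \<Rightarrow> real" where
  "total_rate M (i, k, l) = real k * \<mu>\<^sub>1 M + real (min l (C\<^sub>2 M)) * \<mu>\<^sub>2 M"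

fun holding_rate :: "station_model \<Rightarrow> state \<Rightarrow> real" where
  "holding_rate M (i, k, l) = real i * h\<^sub>0 M + real k * h\<^sub>1 M + real l * h\<^sub>2 M"

text \<open>
  \<open>completable st s\<close>: a service can be completed at station \<open>st\<close> in state \<open>s\<close>.  The completions
  excluded by it have probability \<open>0\<close>.
\<close>

fun completable :: "station \<Rightarrow> state \<Rightarrow> bool" where
  "completable Station1 (i, k, l) = (k \<ge> 1)"
| "completable Station2 (i, k, l) = (l \<ge> 1)"

text \<open>The state reached from \<open>(i, k, l)\<close>; the decision is ignored if the queue is empty.\<close>

fun next_state :: "station \<Rightarrow> decision \<Rightarrow> state \<Rightarrow> state" where
  "next_state Station1 Independent (i, k, l) = (if i = 0 then (0, k - 1, l) else (i - 1, k, l))"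
| "next_state Station1 Collaborative (i, k, l) = (if i = 0 then (0, k - 1, l) else (i - 1, k - 1, l + 1))"
| "next_state Station2 Independent (i, k, l) = (if i = 0 then (0, k, l - 1) else (i - 1, k + 1, l - 1))"
| "next_state Station2 Collaborative (i, k, l) = (if i = 0 then (0, k, l - 1) else (i - 1, k, l))"

text \<open>A policy maps the station that completes first and the current state to a decision.\<close>

type_synonym policy = "station \<Rightarrow> state \<Rightarrow> decision"

text \<open>
  The jump chain under a policy: by competing exponentials, Station 1 completes first with probability
  \<open>k \<mu>\<^sub>1 / d(k, l)\<close> (this is \<open>True\<close> below) and Station 2 with probability \<open>min l C\<^sub>2 \<mu>\<^sub>2 / d(k, l)\<close>.
  The empty system is absorbing.
\<close>

fun step :: "station_model \<Rightarrow> policy \<Rightarrow> state \<Rightarrow> state pmf" where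
  "step M \<pi> (i, k, l) =
     (if (i, k, l) = (0, 0, 0) then return_pmf (0, 0, 0)
      else map_pmf (\<lambda>b. let st = (if b then Station1 else Station2)
                        in next_state st (\<pi> st (i, k, l)) (i, k, l))
             (bernoulli_pmf (real k * \<mu>\<^sub>1 M / total_rate M (i, k, l))))"

primrec state_after :: "station_model \<Rightarrow> policy \<Rightarrow> state \<Rightarrow> nat \<Rightarrow> state pmf" where
  "state_after M \<pi> s 0 = return_pmf s"
| "state_after M \<pi> s (Suc n) = bind_pmf (state_after M \<pi> s n) (step M \<pi>)"

text \<open>
  The sojourn time in a nonempty state is exponential with rate \<open>d(k, l)\<close>, hence has mean
  \<open>1 / d(k, l)\<close>, so this is the expected holding cost between two jumps.  It is \<open>0\<close> in \<open>(0, 0, 0)\<close>.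
\<close>

definition sojourn_cost :: "station_model \<Rightarrow> state \<Rightarrow> real" where
  "sojourn_cost M s = holding_rate M s / total_rate M s"

text \<open>
  Each completion lowers \<open>i + k + l\<close> by one, so for states in \<open>state_space M\<close> only the first
  \<open>i + k + l\<close> terms of the series are nonzero.
\<close>

definition expected_cost :: "station_model \<Rightarrow> policy \<Rightarrow> state \<Rightarrow> real" where
  "expected_cost M \<pi> s =
     (\<Sum>n. measure_pmf.expectation (state_after M \<pi> s n) (sojourn_cost M))"

definition value_fun :: "station_model \<Rightarrow> state \<Rightarrow> real" where
  "value_fun M s = (INF \<pi>. expected_cost M \<pi> s)"

definition optimal_decision :: "station_model \<Rightarrow> station \<Rightarrow> state \<Rightarrow> decision \<Rightarrow> bool" where
  "optimal_decision M st s a \<longleftrightarrow>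
     value_fun M (next_state st a s) =
       min (value_fun M (next_state st Independent s)) (value_fun M (next_state st Collaborative s))"

definition optimal_policy :: "station_model \<Rightarrow> policy \<Rightarrow> bool" where
  "optimal_policy M \<pi> \<longleftrightarrow>
     (\<forall>s \<in> decision_states M. \<forall>st. completable st s \<longrightarrow> optimal_decision M st s (\<pi> st s))"

text \<open>
  Collaborative threshold type with threshold \<open>N\<close>, for completions at station \<open>st\<close> while \<open>l\<close> jobs
  (hence \<open>k = C\<^sub>1 - l\<close> at Station 1) are at Station 2.
\<close>

definition collaborative_threshold ::
    "station_model \<Rightarrow> policy \<Rightarrow> station \<Rightarrow> nat \<Rightarrow> nat \<Rightarrow> bool" where
  "collaborative_threshold M \<pi> st l N \<longleftrightarrow>
     (\<forall>i k. (i, k, l) \<in> decision_states M \<longrightarrow>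
        \<pi> st (i, k, l) = (if i < N then Collaborative else Independent))"

text \<open>The recursion satisfied by \<open>value_fun\<close> on \<open>state_space M\<close>.\<close>

fun jobs :: "state \<Rightarrow> nat" where
  "jobs (i, k, l) = i + k + l"

context
  fixes M :: station_model
  assumes servers: "1 \<le> C\<^sub>2 M" "C\<^sub>2 M < C\<^sub>1 M"
    and rates: "\<mu>\<^sub>1 M > 0" "\<mu>\<^sub>2 M > 0"
begin

lemma total_rate_pos:
  assumes "s \<in> state_space M" "s \<noteq> (0, 0, 0)"
  shows "total_rate M s > 0"
proof -
  obtain i k l where s: "s = (i, k, l)" by (cases s)
  have "k > 0 \<or> l > 0" using assms servers by (auto simp: s state_space_def)
  then have "real k * \<mu>\<^sub>1 M > 0 \<or> real (min l (C\<^sub>2 M)) * \<mu>\<^sub>2 M > 0"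
    using servers rates by auto
  moreover have "real k * \<mu>\<^sub>1 M \<ge> 0" "real (min l (C\<^sub>2 M)) * \<mu>\<^sub>2 M \<ge> 0"
    using rates by auto
  ultimately show ?thesis by (auto simp: s)
qed

lemma next_state_space:
  assumes "s \<in> state_space M" "completable st s"
  shows "next_state st a s \<in> state_space M" "Suc (jobs (next_state st a s)) = jobs s"
  using assms servers
  by (cases s; cases st; cases a; auto simp: state_space_def)+

definition first_prob :: "station \<Rightarrow> state \<Rightarrow> real" where
  "first_prob st s = (case (st, s) of
     (Station1, (i, k, l)) \<Rightarrow> real k * \<mu>\<^sub>1 M / total_rate M s
   | (Station2, (i, k, l)) \<Rightarrow> real (min l (C\<^sub>2 M)) * \<mu>\<^sub>2 M / total_rate M s)"

lemma first_prob:
  assumes "s \<in> state_space M" "s \<noteq> (0, 0, 0)"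
  shows "first_prob st s \<ge> 0" "first_prob Station2 s = 1 - first_prob Station1 s"
    "\<not> completable st s \<Longrightarrow> first_prob st s = 0"
proof -
  obtain i k l where s: "s = (i, k, l)" by (cases s)
  note d = total_rate_pos[OF assms]
  show "first_prob st s \<ge> 0" using d rates by (cases st) (auto simp: first_prob_def s)
  show "first_prob Station2 s = 1 - first_prob Station1 s"
    using d by (simp add: first_prob_def s field_simps)
  show "\<not> completable st s \<Longrightarrow> first_prob st s = 0"
    by (cases st) (auto simp: first_prob_def s)
qed

lemma finite_state_after: "finite (set_pmf (state_after M \<pi> s n))"
proof (induction n)
  case (Suc n)
  have "finite (set_pmf (step M \<pi> t))" for t by (cases t) auto
  with Suc show ?case by simp
qed simp

lemma state_after_Suc:
  "state_after M \<pi> s (Suc n) = bind_pmf (step M \<pi> s) (\<lambda>t. state_after M \<pi> t n)"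
proof (induction n)
  case 0
  show ?case by (simp add: bind_return_pmf bind_return_pmf')
next
  case (Suc n)
  have "state_after M \<pi> s (Suc (Suc n)) = bind_pmf (state_after M \<pi> s (Suc n)) (step M \<pi>)" by simp
  also have "\<dots> = bind_pmf (step M \<pi> s) (\<lambda>t. state_after M \<pi> t (Suc n))"
    unfolding Suc by (simp add: bind_assoc_pmf)
  finally show ?case .
qed

lemma stage_cost_Suc:
  assumes "s \<in> state_space M" "s \<noteq> (0, 0, 0)"
  shows "measure_pmf.expectation (state_after M \<pi> s (Suc n)) f =
    first_prob Station1 s *
      measure_pmf.expectation (state_after M \<pi> (next_state Station1 (\<pi> Station1 s) s) n) f +
    first_prob Station2 s *
      measure_pmf.expectation (state_after M \<pi> (next_state Station2 (\<pi> Station2 s) s) n) f"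
proof -
  define B where "B b = (let st = (if b then Station1 else Station2) in
    state_after M \<pi> (next_state st (\<pi> st s) s) n)" for b
  have p: "0 \<le> first_prob Station1 s" "first_prob Station1 s \<le> 1"
    using first_prob(1)[OF assms, of Station1] first_prob(1)[OF assms, of Station2]
      first_prob(2)[OF assms] by auto
  have "state_after M \<pi> s (Suc n) = bind_pmf (bernoulli_pmf (first_prob Station1 s)) B"
    unfolding state_after_Suc using assms(2)
    by (cases s) (auto simp: bind_map_pmf first_prob_def B_def Let_def intro!: bind_pmf_cong)
  moreover have "measure_pmf.expectation (bind_pmf (bernoulli_pmf (first_prob Station1 s)) B) f =
      (\<Sum>b\<in>UNIV. pmf (bernoulli_pmf (first_prob Station1 s)) b *\<^sub>R measure_pmf.expectation (B b) f)"
    by (rule pmf_expectation_bind) (auto simp: B_def Let_def finite_state_after)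
  ultimately show ?thesis
    using p first_prob(2)[OF assms] by (simp add: UNIV_bool B_def)
qed

lemma stage_cost_empty: "state_after M \<pi> (0, 0, 0) n = return_pmf (0, 0, 0)"
  by (induction n) (auto simp: bind_return_pmf)

lemma sojourn_cost_empty: "sojourn_cost M (0, 0, 0) = 0"
  by (simp add: sojourn_cost_def)

lemma stage_cost_zero:
  assumes "s \<in> state_space M" "jobs s \<le> n"
  shows "measure_pmf.expectation (state_after M \<pi> s n) (sojourn_cost M) = 0"
  using assms
proof (induction n arbitrary: s)
  case 0
  then show ?case by (cases s) (simp add: sojourn_cost_empty)
next
  case (Suc n)
  show ?case
  proof (cases "s = (0, 0, 0)")
    case True
    then show ?thesis using stage_cost_empty[of \<pi> "Suc n"] by (simp add: sojourn_cost_empty)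
  next
    case False
    have "first_prob st s * measure_pmf.expectation
        (state_after M \<pi> (next_state st (\<pi> st s) s) n) (sojourn_cost M) = 0" for st
      using Suc next_state_space[OF Suc.prems(1), of st "\<pi> st s"]
        first_prob(3)[OF Suc.prems(1) False, of st]
      by (cases "completable st s") auto
    then show ?thesis unfolding stage_cost_Suc[OF Suc.prems(1) False] by (simp only: add_0)
  qed
qed

lemma summable_stage_cost:
  assumes "s \<in> state_space M"
  shows "summable (\<lambda>n. measure_pmf.expectation (state_after M \<pi> s n) (sojourn_cost M))"
  by (rule summable_finite[of "{..<jobs s}"]) (auto simp: stage_cost_zero[OF assms] not_less)

lemma expected_cost_empty: "expected_cost M \<pi> (0, 0, 0) = 0"
  by (simp add: expected_cost_def stage_cost_empty sojourn_cost_empty)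

lemma expected_cost_rec:
  assumes "s \<in> state_space M" "s \<noteq> (0, 0, 0)"
  shows "expected_cost M \<pi> s = sojourn_cost M s +
    first_prob Station1 s * expected_cost M \<pi> (next_state Station1 (\<pi> Station1 s) s) +
    first_prob Station2 s * expected_cost M \<pi> (next_state Station2 (\<pi> Station2 s) s)"
proof -
  let ?e = "\<lambda>s n. measure_pmf.expectation (state_after M \<pi> s n) (sojourn_cost M)"
  have *: "(\<lambda>n. first_prob st s * ?e (next_state st (\<pi> st s) s) n) sums
      (first_prob st s * expected_cost M \<pi> (next_state st (\<pi> st s) s))" for st
  proof (cases "completable st s")
    case True
    then show ?thesis
      using summable_stage_cost[OF next_state_space(1)[OF assms(1)]]
      by (auto simp: expected_cost_def intro!: sums_mult)
  qed (simp add: first_prob(3)[OF assms])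
  have "(\<lambda>n. ?e s (Suc n)) sums
     (first_prob Station1 s * expected_cost M \<pi> (next_state Station1 (\<pi> Station1 s) s) +
      first_prob Station2 s * expected_cost M \<pi> (next_state Station2 (\<pi> Station2 s) s))"
    unfolding stage_cost_Suc[OF assms] by (intro sums_add *)
  then show ?thesis
    using suminf_split_head[OF summable_stage_cost[OF assms(1)], of \<pi>]
    by (simp add: expected_cost_def sums_iff del: state_after.simps(2))
qed

lemma expected_cost_cong:
  assumes "s \<in> state_space M" "\<And>t st. jobs t \<le> jobs s \<Longrightarrow> \<pi> st t = \<pi>' st t"
  shows "expected_cost M \<pi> s = expected_cost M \<pi>' s"
  using assms
proof (induction "jobs s" arbitrary: s rule: less_induct)
  case less
  show ?case
  proof (cases "s = (0, 0, 0)")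
    case False
    have "first_prob st s * expected_cost M \<pi> (next_state st (\<pi> st s) s) =
        first_prob st s * expected_cost M \<pi>' (next_state st (\<pi>' st s) s)" for st
    proof (cases "completable st s")
      case True
      note n = next_state_space[OF less.prems(1) True, of "\<pi>' st s"]
      have "expected_cost M \<pi> (next_state st (\<pi>' st s) s) =
          expected_cost M \<pi>' (next_state st (\<pi>' st s) s)"
        by (rule less.hyps) (use n less.prems in auto)
      then show ?thesis using less.prems(2)[of s st] by simp
    qed (simp add: first_prob(3)[OF less.prems(1) False])
    then show ?thesis unfolding expected_cost_rec[OF less.prems(1) False] by (simp only:)
  qed (simp add: expected_cost_empty)
qed

lemma optimal_up_to:
  "\<exists>\<pi>. \<forall>s\<in>state_space M. jobs s \<le> n \<longrightarrow> (\<forall>\<pi>'. expected_cost M \<pi> s \<le> expected_cost M \<pi>' s)"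
proof (induction n)
  case 0
  have "s = (0, 0, 0)" if "jobs s = 0" for s using that by (cases s) auto
  then show ?case by (auto simp: expected_cost_empty)
next
  case (Suc n)
  then obtain \<pi> where \<pi>: "\<And>s \<pi>'. s \<in> state_space M \<Longrightarrow> jobs s \<le> n \<Longrightarrow>
    expected_cost M \<pi> s \<le> expected_cost M \<pi>' s" by auto
  define \<rho> where "\<rho> st s = (if jobs s \<le> n then \<pi> st s else
     if expected_cost M \<pi> (next_state st Independent s) \<le>
        expected_cost M \<pi> (next_state st Collaborative s)
     then Independent else Collaborative)" for st s
  have eq: "expected_cost M \<rho> s = expected_cost M \<pi> s" if "s \<in> state_space M" "jobs s \<le> n" for s
    by (rule expected_cost_cong) (use that in \<open>auto simp: \<rho>_def\<close>)
  have "expected_cost M \<rho> s \<le> expected_cost M \<pi>' s"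
    if s: "s \<in> state_space M" "jobs s \<le> Suc n" for s \<pi>'
  proof (cases "jobs s \<le> n")
    case True
    then show ?thesis using eq \<pi> s by auto
  next
    case False
    then have ne: "s \<noteq> (0, 0, 0)" by auto
    have "first_prob st s * expected_cost M \<rho> (next_state st (\<rho> st s) s) \<le>
        first_prob st s * expected_cost M \<pi>' (next_state st (\<pi>' st s) s)" for st
    proof (cases "completable st s")
      case True
      have n: "next_state st a s \<in> state_space M" "jobs (next_state st a s) \<le> n" for a
        using next_state_space[OF s(1) True, of a] s by auto
      have "expected_cost M \<rho> (next_state st (\<rho> st s) s) =
          expected_cost M \<pi> (next_state st (\<rho> st s) s)"
        using n eq by blast
      also have "\<dots> \<le> expected_cost M \<pi> (next_state st (\<pi>' st s) s)"
        using False by (cases "\<pi>' st s") (auto simp: \<rho>_def)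
      also have "\<dots> \<le> expected_cost M \<pi>' (next_state st (\<pi>' st s) s)"
        using n \<pi> by blast
      finally show ?thesis by (intro mult_left_mono first_prob(1)[OF s(1) ne])
    qed (simp add: first_prob(3)[OF s(1) ne])
    from this[of Station1] this[of Station2] show ?thesis
      unfolding expected_cost_rec[OF s(1) ne] by linarith
  qed
  then show ?case by blast
qed

lemma value_fun_eq:
  assumes "\<And>\<pi>'. expected_cost M \<pi> s \<le> expected_cost M \<pi>' s"
  shows "value_fun M s = expected_cost M \<pi> s"
  unfolding value_fun_def by (rule cInf_eq_minimum) (use assms in auto)

lemma value_fun_rec:
  assumes "s \<in> state_space M" "s \<noteq> (0, 0, 0)"
  shows "value_fun M s = sojourn_cost M s +
    (\<Sum>st\<in>{Station1, Station2}. first_prob st s *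
      min (value_fun M (next_state st Independent s)) (value_fun M (next_state st Collaborative s)))"
proof -
  obtain \<pi> where \<pi>: "\<And>t \<pi>'. t \<in> state_space M \<Longrightarrow> jobs t \<le> jobs s \<Longrightarrow>
    expected_cost M \<pi> t \<le> expected_cost M \<pi>' t" using optimal_up_to[of "jobs s"] by blast
  have v: "value_fun M t = expected_cost M \<pi> t" if "t \<in> state_space M" "jobs t \<le> jobs s" for t
    by (rule value_fun_eq) (use \<pi> that in auto)
  define \<rho> where "\<rho> st t = (if t \<noteq> s then \<pi> st t else
     if expected_cost M \<pi> (next_state st Independent s) \<le>
        expected_cost M \<pi> (next_state st Collaborative s)
     then Independent else Collaborative)" for st t
  let ?m = "\<lambda>st. min (value_fun M (next_state st Independent s))
    (value_fun M (next_state st Collaborative s))"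
  have n: "next_state st a s \<in> state_space M" "jobs (next_state st a s) < jobs s"
    if "completable st s" for st a
    using next_state_space[OF assms(1) that, of a] by auto
  have "first_prob st s * expected_cost M \<rho> (next_state st (\<rho> st s) s) = first_prob st s * ?m st" for st
  proof (cases "completable st s")
    case True
    have "expected_cost M \<rho> (next_state st (\<rho> st s) s) = expected_cost M \<pi> (next_state st (\<rho> st s) s)"
      by (rule expected_cost_cong) (use n[OF True, of "\<rho> st s"] in \<open>auto simp: \<rho>_def\<close>)
    also have "\<dots> = ?m st" using n[OF True] by (auto simp: v less_imp_le \<rho>_def)
    finally show ?thesis by simp
  qed (simp add: first_prob(3)[OF assms])
  then have "expected_cost M \<rho> s =
      sojourn_cost M s + first_prob Station1 s * ?m Station1 + first_prob Station2 s * ?m Station2"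
    unfolding expected_cost_rec[OF assms] by (simp only:)
  moreover have "first_prob st s * ?m st \<le>
      first_prob st s * expected_cost M \<pi> (next_state st (\<pi> st s) s)" for st
  proof (cases "completable st s")
    case True
    have "?m st \<le> value_fun M (next_state st (\<pi> st s) s)" by (cases "\<pi> st s") auto
    also have "\<dots> = expected_cost M \<pi> (next_state st (\<pi> st s) s)"
      using n[OF True] by (simp add: v less_imp_le)
    finally show ?thesis by (intro mult_left_mono first_prob(1)[OF assms])
  qed (simp add: first_prob(3)[OF assms])
  from this[of Station1] this[of Station2]
  have "sojourn_cost M s + first_prob Station1 s * ?m Station1 + first_prob Station2 s * ?m Station2
      \<le> expected_cost M \<pi> s"
    unfolding expected_cost_rec[OF assms] by linarith
  moreover have "expected_cost M \<pi> s \<le> expected_cost M \<rho> s" using \<pi> assms by auto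
  ultimately show ?thesis using v[OF assms(1)] by simp
qed

lemma value_fun_empty: "value_fun M (0, 0, 0) = 0"
  by (simp add: value_fun_def expected_cost_empty)

lemma value_fun_no_queue:
  assumes "(0, k, l) \<in> state_space M" "(k, l) \<noteq> (0, 0)"
  defines "d \<equiv> total_rate M (0, k, l)"
  shows "value_fun M (0, k, l) = (real k * h\<^sub>1 M + real l * h\<^sub>2 M) / d
    + real k * \<mu>\<^sub>1 M / d * value_fun M (0, k - 1, l)
    + real (min l (C\<^sub>2 M)) * \<mu>\<^sub>2 M / d * value_fun M (0, k, l - 1)"
  using value_fun_rec[OF assms(1)] assms(2)
  by (simp add: sojourn_cost_def first_prob_def d_def del: total_rate.simps)

lemma value_fun_queue:
  assumes "i \<ge> 1" "k + l = C\<^sub>1 M"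
  defines "d \<equiv> total_rate M (i, k, l)"
  shows "value_fun M (i, k, l) = (real i * h\<^sub>0 M + real k * h\<^sub>1 M + real l * h\<^sub>2 M) / d
    + real k * \<mu>\<^sub>1 M / d *
        min (value_fun M (i - 1, k, l)) (value_fun M (i - 1, k - 1, l + 1))
    + real (min l (C\<^sub>2 M)) * \<mu>\<^sub>2 M / d *
        min (value_fun M (i - 1, k + 1, l - 1)) (value_fun M (i - 1, k, l))"
  using value_fun_rec[of "(i, k, l)"] assms(1,2)
  by (simp add: sojourn_cost_def first_prob_def d_def state_space_def del: total_rate.simps)

end

end

theory Submission
  imports Defs
begin

text \<open>
  In a decision state all \<open>C\<^sub>1\<close> Type-I servers are busy, so the state is \<open>(i, C\<^sub>1 - l, l)\<close> and every decision
  chooses between two neighbouring values of \<open>l\<close>. Everything is therefore governed by the sign of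
  \[ D_i(l) = v(i, C_1 - l, l) - v(i, C_1 - l - 1, l + 1) , \]
  called \<open>gain\<close> below: collaborative service is optimal for \<open>D \<ge> 0\<close> and independent service for \<open>D \<le> 0\<close>.

  Write \<open>d l\<close> for the total rate, \<open>q l\<close> and \<open>p l = 1 - q l\<close> for the probabilities that Station 1 and Station 2
  complete first, and \<open>x\<^sup>+ = max x 0\<close>, \<open>x\<^sup>- = max (- x) 0\<close>. Subtracting the optimality equations of two neighbours
  and replacing each minimum \<open>min a b\<close> by \<open>a - (a - b)\<^sup>+ = b - (a - b)\<^sup>-\<close> eliminates \<open>v\<close> (\<open>gain_Suc\<close>):
  \[ D_{i+1}(l) = (i+1) h_0 (1/d_l - 1/d_{l+1}) + p_{l+1} D_0(l) - p_l D_0(l-1)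
     + p_l (D_i(l)^+ - D_i(l-1)^-) + q_{l+1} (D_i(l+1)^+ - D_i(l)^-) . \]
  The right-hand side is nondecreasing in each value of \<open>D\<^sub>i\<close>. Apart from them it depends on \<open>i\<close> only through its
  first term, whose sign is that of \<open>d (l + 1) - d l\<close>, that is, of \<open>\<mu>\<^sub>2 - \<mu>\<^sub>1\<close> if \<open>l < C\<^sub>2\<close> and of \<open>- \<mu>\<^sub>1\<close> otherwise.

  If \<open>l < C\<^sub>2\<close> and \<open>\<mu>\<^sub>1 \<le> \<mu>\<^sub>2\<close>, then that term is nonnegative, and nonnegativity of the gain propagates from \<open>i\<close> to
  \<open>i + 1\<close> (\<open>gain_nonneg\<close>). In all other cases the term decreases in \<open>i\<close>, so that \<open>D\<^sub>1 \<le> D\<^sub>0\<close> propagates to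
  \<open>D\<^sub>i\<^sub>+\<^sub>1 \<le> D\<^sub>i\<close> for every \<open>i\<close> (\<open>gain_Suc_le\<close>); the initial inequality holds because the gain with an empty queue,
  \<open>D\<^sub>0 l = h\<^sub>1 / \<mu>\<^sub>1 - (l + 1) h\<^sub>2 / (min (l + 1) C\<^sub>2 \<mu>\<^sub>2)\<close>, is nonincreasing in \<open>l\<close>. A gain that is nonincreasing in \<open>i\<close>
  changes sign at most once, and the linear first term drives it to a nonpositive value (\<open>eventually_gain_nonpos\<close>);
  this is a finite threshold. It is zero when \<open>D\<^sub>0 l \<le> 0\<close>, which is the condition for permanent independent service.
\<close>

section \<open>The gain of collaborative over independent service\<close>

locale service_system =
  fixes M :: station_model
  assumes servers: "1 \<le> C\<^sub>2 M" "C\<^sub>2 M < C\<^sub>1 M"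
    and rates: "\<mu>\<^sub>1 M > 0" "\<mu>\<^sub>2 M > 0"
begin

definition busy_value :: "nat \<Rightarrow> nat \<Rightarrow> real" where
  "busy_value i l = value_fun M (i, C\<^sub>1 M - l, l)"

definition gain :: "nat \<Rightarrow> nat \<Rightarrow> real" where
  "gain i l = busy_value i l - busy_value i (Suc l)"

definition rate :: "nat \<Rightarrow> real" where
  "rate l = real (C\<^sub>1 M - l) * \<mu>\<^sub>1 M + real (min l (C\<^sub>2 M)) * \<mu>\<^sub>2 M"

definition q :: "nat \<Rightarrow> real" where
  "q l = real (C\<^sub>1 M - l) * \<mu>\<^sub>1 M / rate l"

definition p :: "nat \<Rightarrow> real" where
  "p l = real (min l (C\<^sub>2 M)) * \<mu>\<^sub>2 M / rate l"

text \<open>The expected holding cost at Station 2 until the next completion there, when it starts with \<open>l\<close> jobs.\<close>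

definition drain_cost :: "nat \<Rightarrow> real" where
  "drain_cost l = real l * h\<^sub>2 M / (real (min l (C\<^sub>2 M)) * \<mu>\<^sub>2 M)"

lemma rate_pos:
  assumes "l \<le> C\<^sub>1 M"
  shows "rate l > 0"
proof -
  have "total_rate M (0, C\<^sub>1 M - l, l) > 0"
    by (rule total_rate_pos[OF servers rates]) (use assms servers in \<open>auto simp: state_space_def\<close>)
  then show ?thesis by (simp add: rate_def)
qed

lemma p_nonneg: "l \<le> C\<^sub>1 M \<Longrightarrow> p l \<ge> 0"
  and q_nonneg: "l \<le> C\<^sub>1 M \<Longrightarrow> q l \<ge> 0"
  using rate_pos[of l] rates by (auto simp: p_def q_def)

lemma q_eq: "l \<le> C\<^sub>1 M \<Longrightarrow> q l = 1 - p l"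
  using rate_pos[of l]
  by (simp add: p_def q_def eq_diff_eq add_divide_distrib[symmetric]) (simp add: rate_def)

lemma p_0 [simp]: "p 0 = 0"
  by (simp add: p_def)

lemma q_C1 [simp]: "q (C\<^sub>1 M) = 0"
  by (simp add: q_def)

lemma rate_Suc:
  assumes "l < C\<^sub>1 M"
  shows "rate (Suc l) = rate l - \<mu>\<^sub>1 M + (if l < C\<^sub>2 M then \<mu>\<^sub>2 M else 0)"
proof -
  have "real (C\<^sub>1 M - l) = real (C\<^sub>1 M - Suc l) + 1" using assms by simp
  then show ?thesis by (auto simp: rate_def min_def algebra_simps)
qed

lemma p_mono_below_C2:
  assumes "l < C\<^sub>2 M"
  shows "p l \<le> p (Suc l)"
proof -
  let ?a = "real (C\<^sub>1 M - Suc l) * \<mu>\<^sub>1 M" and ?b = "real l * \<mu>\<^sub>2 M"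
  have d: "rate l > 0" "rate (Suc l) > 0" using rate_pos assms servers by auto
  have "real (C\<^sub>1 M - l) = real (C\<^sub>1 M - Suc l) + 1" using assms servers by simp
  then have r: "rate l = ?a + \<mu>\<^sub>1 M + ?b" "rate (Suc l) = ?a + ?b + \<mu>\<^sub>2 M"
    using assms by (auto simp: rate_def algebra_simps)
  have "?b * rate (Suc l) \<le> (?b + \<mu>\<^sub>2 M) * rate l"
    unfolding r using rates by (simp add: algebra_simps)
  then have "?b / rate l \<le> (?b + \<mu>\<^sub>2 M) / rate (Suc l)"
    using d by (simp add: field_simps)
  then show ?thesis using assms by (simp add: p_def algebra_simps)
qed

section \<open>The gain with an empty queue\<close>

text \<open>With an empty queue the two stations no longer interact, so their draining costs add up.\<close>

lemma value_fun_empty_queue: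
  assumes "k + l \<le> C\<^sub>1 M"
  shows "value_fun M (0, k, l) = real k * (h\<^sub>1 M / \<mu>\<^sub>1 M) + (\<Sum>j=1..l. drain_cost j)"
  using assms
proof (induction "k + l" arbitrary: k l rule: less_induct)
  case less
  let ?r = "h\<^sub>1 M / \<mu>\<^sub>1 M" and ?a = "real k * \<mu>\<^sub>1 M" and ?b = "real (min l (C\<^sub>2 M)) * \<mu>\<^sub>2 M"
  let ?V = "real k * ?r + (\<Sum>j=1..l. drain_cost j)"
  show ?case
  proof (cases "k = 0 \<and> l = 0")
    case True
    then show ?thesis by (simp add: value_fun_empty[OF servers rates])
  next
    case False
    have s: "(0, k, l) \<in> state_space M" using less.prems by (auto simp: state_space_def)
    have d: "?a + ?b > 0" using total_rate_pos[OF servers rates s] False by simp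
    have k: "?a * value_fun M (0, k - 1, l) = ?a * (?V - ?r)"
    proof (cases "k = 0")
      case False
      then have "real k * ?r = real (k - 1) * ?r + ?r"
        by (simp add: of_nat_diff left_diff_distrib diff_divide_distrib)
      then show ?thesis using less.hyps[of "k - 1" l] less.prems False by simp
    qed simp
    have l: "?b * value_fun M (0, k, l - 1) = ?b * (?V - drain_cost l)"
      using less.hyps[of k "l - 1"] less.prems by (cases l) (auto simp: algebra_simps)
    have c: "real k * h\<^sub>1 M + real l * h\<^sub>2 M = ?a * ?r + ?b * drain_cost l"
      using rates servers by (cases "l = 0") (auto simp: drain_cost_def)
    have "value_fun M (0, k, l) =
        (real k * h\<^sub>1 M + real l * h\<^sub>2 M + ?a * value_fun M (0, k - 1, l)
          + ?b * value_fun M (0, k, l - 1)) / (?a + ?b)"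
      using value_fun_no_queue[OF servers rates s] False by (simp add: add_divide_distrib)
    also have "\<dots> = (?a + ?b) * ?V / (?a + ?b)"
      unfolding k l c by (simp add: algebra_simps)
    finally show ?thesis using d by simp
  qed
qed

lemma gain_0:
  assumes "l < C\<^sub>1 M"
  shows "gain 0 l = h\<^sub>1 M / \<mu>\<^sub>1 M - drain_cost (Suc l)"
proof -
  have "real (C\<^sub>1 M - l) = real (C\<^sub>1 M - Suc l) + 1" using assms by simp
  then show ?thesis
    using assms by (simp add: gain_def busy_value_def value_fun_empty_queue algebra_simps add_divide_distrib)
qed

lemma drain_cost_below_C2: "1 \<le> l \<Longrightarrow> l \<le> C\<^sub>2 M \<Longrightarrow> drain_cost l = h\<^sub>2 M / \<mu>\<^sub>2 M"
  by (simp add: drain_cost_def)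

lemma drain_cost_above_C2: "C\<^sub>2 M \<le> l \<Longrightarrow> drain_cost l = real l / real (C\<^sub>2 M) * (h\<^sub>2 M / \<mu>\<^sub>2 M)"
  by (simp add: drain_cost_def min_def)

lemma gain_0_antimono:
  assumes "Suc l < C\<^sub>1 M" "h\<^sub>2 M > 0"
  shows "gain 0 (Suc l) \<le> gain 0 l"
proof -
  have "drain_cost (Suc l) \<le> drain_cost (Suc (Suc l))"
  proof (cases "Suc l < C\<^sub>2 M")
    case True
    then show ?thesis by (simp add: drain_cost_below_C2)
  next
    case False
    then show ?thesis
      using servers rates assms by (simp add: drain_cost_above_C2 divide_right_mono mult_right_mono)
  qed
  then show ?thesis using assms by (simp add: gain_0)
qed

section \<open>The recursion for the gain\<close>

text \<open>
  The cost rate at the stations is rewritten through the gain with an empty queue: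
  \<open>k h\<^sub>1 + l h\<^sub>2 = d l (h\<^sub>1 / \<mu>\<^sub>1 - p l D\<^sub>0 (l - 1))\<close>. In this form the constant term of the recursion for the gain
  resembles its other terms, with which it is compared in the base case of \<open>gain_Suc_le\<close>.
  For \<open>l = 0\<close> and for \<open>l = C\<^sub>1\<close> the meaningless gains have coefficient \<open>0\<close>.
\<close>

lemma busy_value_Suc:
  assumes "l \<le> C\<^sub>1 M"
  shows "busy_value (Suc i) l = busy_value i l + real (Suc i) * h\<^sub>0 M / rate l + h\<^sub>1 M / \<mu>\<^sub>1 M
    - p l * gain 0 (l - 1) - q l * max (gain i l) 0 - p l * max (- gain i (l - 1)) 0"
proof -
  let ?k = "C\<^sub>1 M - l" and ?r = "h\<^sub>1 M / \<mu>\<^sub>1 M"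
  let ?b = "real (min l (C\<^sub>2 M)) * \<mu>\<^sub>2 M"
  have d: "rate l > 0" using rate_pos assms by simp
  have "real ?k * h\<^sub>1 M + real l * h\<^sub>2 M = rate l * ?r - ?b * gain 0 (l - 1)"
  proof (cases "l = 0")
    case True
    then show ?thesis using rates by (simp add: rate_def)
  next
    case False
    have "?b * drain_cost l = real l * h\<^sub>2 M"
      using False servers rates by (simp add: drain_cost_def)
    moreover have "real ?k * \<mu>\<^sub>1 M * ?r = real ?k * h\<^sub>1 M" using rates by simp
    ultimately show ?thesis using False assms by (simp add: gain_0 rate_def algebra_simps)
  qed
  then have cost: "(real (Suc i) * h\<^sub>0 M + real ?k * h\<^sub>1 M + real l * h\<^sub>2 M) / rate l =
      real (Suc i) * h\<^sub>0 M / rate l + ?r - p l * gain 0 (l - 1)"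
    using d by (simp add: p_def diff_divide_distrib add_divide_distrib add.assoc)
  have 1: "q l * min (value_fun M (i, ?k, l)) (value_fun M (i, ?k - 1, l + 1)) =
      q l * (busy_value i l - max (gain i l) 0)"
    by (auto simp: gain_def busy_value_def min_def max_def)
  have 2: "p l * min (value_fun M (i, ?k + 1, l - 1)) (value_fun M (i, ?k, l)) =
      p l * (busy_value i l - max (- gain i (l - 1)) 0)"
  proof (cases "l = 0")
    case False
    then have "?k + 1 = C\<^sub>1 M - (l - 1)" using assms by simp
    then show ?thesis using False by (auto simp: gain_def busy_value_def min_def max_def)
  qed simp
  have "busy_value (Suc i) l =
      (real (Suc i) * h\<^sub>0 M + real ?k * h\<^sub>1 M + real l * h\<^sub>2 M) / rate l
      + q l * min (value_fun M (i, ?k, l)) (value_fun M (i, ?k - 1, l + 1))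
      + p l * min (value_fun M (i, ?k + 1, l - 1)) (value_fun M (i, ?k, l))"
    using value_fun_queue[OF servers rates, of "Suc i" ?k l] assms
    by (simp add: busy_value_def p_def q_def rate_def)
  then show ?thesis unfolding 1 2 cost by (simp add: q_eq[OF assms] algebra_simps)
qed

lemma gain_Suc:
  assumes "l < C\<^sub>1 M"
  shows "gain (Suc i) l = real (Suc i) * h\<^sub>0 M * (1 / rate l - 1 / rate (Suc l))
    + p (Suc l) * gain 0 l - p l * gain 0 (l - 1)
    + p l * (max (gain i l) 0 - max (- gain i (l - 1)) 0)
    + q (Suc l) * (max (gain i (Suc l)) 0 - max (- gain i l) 0)"
proof -
  have "busy_value i l - busy_value i (Suc l) = max (gain i l) 0 - max (- gain i l) 0"
    by (simp add: gain_def max_def)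
  moreover have "gain (Suc i) l = busy_value (Suc i) l - busy_value (Suc i) (Suc l)"
    by (simp add: gain_def)
  ultimately show ?thesis
    using busy_value_Suc[of l i] busy_value_Suc[of "Suc l" i] assms
    by (simp add: q_eq algebra_simps add_divide_distrib)
qed

section \<open>Sign and monotonicity of the gain\<close>

text \<open>
  A fast collaborative station with idle servers is always worth joining: moving a job there does not
  lower the total rate, and below \<open>C\<^sub>2\<close> the gain with an empty queue does not depend on \<open>l\<close>, so that the constant
  term of the recursion is a nonnegative multiple of \<open>p (Suc l) - p l \<ge> 0\<close>.
\<close>

lemma gain_nonneg:
  assumes "\<mu>\<^sub>1 M \<le> \<mu>\<^sub>2 M" "h\<^sub>0 M > 0" "h\<^sub>1 M / \<mu>\<^sub>1 M \<ge> h\<^sub>2 M / \<mu>\<^sub>2 M" "l < C\<^sub>2 M"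
  shows "gain i l \<ge> 0"
  using assms(4)
proof (induction i arbitrary: l)
  case 0
  then show ?case using servers assms by (simp add: gain_0 drain_cost_below_C2)
next
  case (Suc i)
  let ?\<delta> = "h\<^sub>1 M / \<mu>\<^sub>1 M - h\<^sub>2 M / \<mu>\<^sub>2 M"
  have l: "l < C\<^sub>1 M" using Suc.prems servers by simp
  have d: "rate l > 0" "rate l \<le> rate (Suc l)"
    using rate_pos[of l] rate_Suc[OF l] l Suc.prems assms(1) by auto
  have "1 / rate (Suc l) \<le> 1 / rate l" using d by (intro divide_left_mono) auto
  then have h: "real (Suc i) * h\<^sub>0 M * (1 / rate l - 1 / rate (Suc l)) \<ge> 0" using assms(2) by simp
  have "gain 0 l = ?\<delta>" "gain 0 (l - 1) = ?\<delta>"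
    using Suc.prems servers by (auto simp: gain_0 drain_cost_below_C2)
  moreover have "p l * ?\<delta> \<le> p (Suc l) * ?\<delta>"
    using p_mono_below_C2[OF Suc.prems] assms(3) by (intro mult_right_mono) auto
  ultimately have c: "p (Suc l) * gain 0 l - p l * gain 0 (l - 1) \<ge> 0" by simp
  have "gain i l \<ge> 0" "gain i (l - 1) \<ge> 0" using Suc.IH Suc.prems by auto
  then have "p l * (max (gain i l) 0 - max (- gain i (l - 1)) 0) \<ge> 0"
      "q (Suc l) * (max (gain i (Suc l)) 0 - max (- gain i l) 0) \<ge> 0"
    using p_nonneg[of l] q_nonneg[of "Suc l"] l by (auto simp: max_def)
  with h c show ?case unfolding gain_Suc[OF l] by linarith
qed

end

locale cost_system = service_system +
  assumes costs: "h\<^sub>0 M > 0" "h\<^sub>2 M > 0"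
    and index_order: "h\<^sub>1 M / \<mu>\<^sub>1 M \<ge> h\<^sub>2 M / \<mu>\<^sub>2 M"
begin

text \<open>For \<open>l < C\<^sub>1\<close> this is equivalent to \<open>rate (Suc l) < rate l\<close>: moving a job to Station 2 slows the system down.\<close>

definition slows :: "nat \<Rightarrow> bool" where
  "slows l \<longleftrightarrow> l < C\<^sub>1 M \<and> (C\<^sub>2 M \<le> l \<or> \<mu>\<^sub>2 M < \<mu>\<^sub>1 M)"

lemma slows_rate:
  assumes "slows l"
  shows "1 / rate l - 1 / rate (Suc l) < 0"
proof -
  have "rate (Suc l) > 0" "rate (Suc l) < rate l"
    using assms rate_pos[of "Suc l"] rate_Suc[of l] rates by (auto simp: slows_def)
  then show ?thesis by (simp add: divide_strict_left_mono)
qed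

text \<open>
  In the induction step every gain that has a nonzero coefficient in the recursion either does not rise with \<open>i\<close>
  or occurs through a negative part that vanishes throughout. The latter is needed only at the boundary \<open>l = C\<^sub>2\<close> in the case
  \<open>\<mu>\<^sub>1 \<le> \<mu>\<^sub>2\<close>, where \<open>gain_nonneg\<close> applies to \<open>l - 1\<close>.
\<close>

lemma gain_Suc_le:
  assumes "slows l"
  shows "gain (Suc i) l \<le> gain i l"
  using assms
proof (induction i arbitrary: l)
  case 0
  have l: "l < C\<^sub>1 M" using 0 by (simp add: slows_def)
  have h: "h\<^sub>0 M * (1 / rate l - 1 / rate (Suc l)) \<le> 0"
    using slows_rate[OF 0] costs by (simp add: mult_nonneg_nonpos)
  \<comment> \<open>Replacing \<open>D\<^sub>0 (l - 1)\<close> and \<open>D\<^sub>0 (l + 1)\<close> by \<open>D\<^sub>0 l\<close> only increases the bound, as \<open>D\<^sub>0\<close> is nonincreasing in \<open>l\<close>;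
    what remains is \<open>(p (l + 1) + q (l + 1)) D\<^sub>0 l = D\<^sub>0 l\<close>.\<close>
  have "max (gain 0 l) 0 - max (- gain 0 (l - 1)) 0 \<le> gain 0 (l - 1)"
    using gain_0_antimono[of "l - 1"] l costs by (cases l) (auto simp: max_def)
  then have "p l * (max (gain 0 l) 0 - max (- gain 0 (l - 1)) 0) \<le> p l * gain 0 (l - 1)"
    using p_nonneg l by (simp add: mult_left_mono)
  moreover have "q (Suc l) * (max (gain 0 (Suc l)) 0 - max (- gain 0 l) 0) \<le> q (Suc l) * gain 0 l"
  proof (cases "Suc l = C\<^sub>1 M")
    case False
    then have "max (gain 0 (Suc l)) 0 - max (- gain 0 l) 0 \<le> gain 0 l"
      using gain_0_antimono[of l] l costs by (auto simp: max_def)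
    then show ?thesis using q_nonneg l by (simp add: mult_left_mono)
  qed simp
  moreover have "p (Suc l) * gain 0 l + q (Suc l) * gain 0 l = gain 0 l"
    using l by (simp add: q_eq algebra_simps)
  ultimately show ?case using h unfolding gain_Suc[OF l] by simp
next
  case (Suc i)
  have l: "l < C\<^sub>1 M" using Suc.prems by (simp add: slows_def)
  have h: "real (Suc (Suc i)) * h\<^sub>0 M * (1 / rate l - 1 / rate (Suc l)) \<le>
      real (Suc i) * h\<^sub>0 M * (1 / rate l - 1 / rate (Suc l))"
    using slows_rate[OF Suc.prems] costs by (intro mult_right_mono_neg mult_right_mono) auto
  have here: "gain (Suc i) l \<le> gain i l" using Suc.IH Suc.prems by simp
  have "p l * (max (gain (Suc i) l) 0 - max (- gain (Suc i) (l - 1)) 0) \<le>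
      p l * (max (gain i l) 0 - max (- gain i (l - 1)) 0)"
  proof (cases "l = 0")
    case False
    have "max (- gain i (l - 1)) 0 \<le> max (- gain (Suc i) (l - 1)) 0"
    proof (cases "slows (l - 1)")
      case True
      then show ?thesis using Suc.IH[of "l - 1"] by simp
    next
      case n: False
      then have "l - 1 < C\<^sub>2 M" "\<mu>\<^sub>1 M \<le> \<mu>\<^sub>2 M"
        using l False Suc.prems by (auto simp: slows_def)
      then have "gain i (l - 1) \<ge> 0" using gain_nonneg costs index_order by blast
      then show ?thesis by simp
    qed
    with here show ?thesis using p_nonneg l by (intro mult_left_mono) auto
  qed simp
  moreover have "q (Suc l) * (max (gain (Suc i) (Suc l)) 0 - max (- gain (Suc i) l) 0) \<le>
      q (Suc l) * (max (gain i (Suc l)) 0 - max (- gain i l) 0)"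
  proof (cases "Suc l = C\<^sub>1 M")
    case False
    then have "slows (Suc l)" using Suc.prems by (auto simp: slows_def)
    with here Suc.IH[of "Suc l"] show ?thesis using q_nonneg l by (intro mult_left_mono) auto
  qed simp
  ultimately show ?case using h unfolding gain_Suc[OF l] by linarith
qed

lemma gain_antimono:
  assumes "slows l" "i \<le> j"
  shows "gain j l \<le> gain i l"
  using lift_Suc_antimono_le[of "\<lambda>i. gain i l"] gain_Suc_le assms by blast

text \<open>
  The gains on the right-hand side of the recursion are bounded above by their values for \<open>i = 0\<close>,
  whereas the term proportional to \<open>i\<close> tends to \<open>-\<infinity>\<close>.
\<close>

lemma eventually_gain_nonpos:
  assumes "slows l"
  shows "\<exists>i. gain i l \<le> 0"
proof -
  have l: "l < C\<^sub>1 M" using assms by (simp add: slows_def)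
  define c where "c = h\<^sub>0 M * (1 / rate (Suc l) - 1 / rate l)"
  let ?B = "p (Suc l) * gain 0 l - p l * gain 0 (l - 1)
    + p l * max (gain 0 l) 0 + q (Suc l) * max (gain 0 (Suc l)) 0"
  have c: "c > 0" using slows_rate[OF assms] costs by (simp add: c_def)
  then obtain n where n: "?B < real n * c" using reals_Archimedean3 by blast
  have "p l * (max (gain n l) 0 - max (- gain n (l - 1)) 0) \<le> p l * max (gain 0 l) 0"
    using gain_antimono[OF assms, of 0 n] p_nonneg l by (intro mult_left_mono) auto
  moreover have "q (Suc l) * (max (gain n (Suc l)) 0 - max (- gain n l) 0) \<le>
      q (Suc l) * max (gain 0 (Suc l)) 0"
  proof (cases "Suc l = C\<^sub>1 M")
    case False
    then have "slows (Suc l)" using assms by (auto simp: slows_def)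
    then show ?thesis using gain_antimono[of "Suc l" 0 n] q_nonneg l by (intro mult_left_mono) auto
  qed simp
  moreover have "real (Suc n) * h\<^sub>0 M * (1 / rate l - 1 / rate (Suc l)) = - (real n * c) - c"
    by (simp add: c_def algebra_simps add_divide_distrib)
  ultimately have "gain (Suc n) l \<le> 0" using n c gain_Suc[OF l, of n] by linarith
  then show ?thesis by blast
qed

section \<open>From the gain to optimal decisions\<close>

text \<open>
  A completion at Station 1 with \<open>l\<close> jobs at Station 2 poses the same choice as one at Station 2 with \<open>l + 1\<close> jobs
  there, so that a single gain, at \<open>m\<close>, serves both stations.
\<close>

lemma optimal_decision_gain:
  assumes "k + l = C\<^sub>1 M" "i \<ge> 1"
    and "st = Station1 \<and> k \<ge> 1 \<and> m = l \<or> st = Station2 \<and> l \<ge> 1 \<and> m = l - 1"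
  shows "optimal_decision M st (i, k, l) Collaborative \<longleftrightarrow> gain (i - 1) m \<ge> 0"
    and "optimal_decision M st (i, k, l) Independent \<longleftrightarrow> gain (i - 1) m \<le> 0"
proof -
  have m: "k = C\<^sub>1 M - l" "l \<ge> 1 \<Longrightarrow> k + 1 = C\<^sub>1 M - (l - 1)" using assms(1) by auto
  have "next_state st Independent (i, k, l) = (i - 1, C\<^sub>1 M - m, m)"
    "next_state st Collaborative (i, k, l) = (i - 1, C\<^sub>1 M - Suc m, Suc m)"
    using assms m by auto
  then show "optimal_decision M st (i, k, l) Collaborative \<longleftrightarrow> gain (i - 1) m \<ge> 0"
    and "optimal_decision M st (i, k, l) Independent \<longleftrightarrow> gain (i - 1) m \<le> 0"
    by (auto simp: optimal_decision_def gain_def busy_value_def min_def)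
qed

text \<open>A policy that is optimal everywhere may be altered at will where the new decisions are optimal too.\<close>

lemma optimal_threshold_policy:
  assumes "k + l = C\<^sub>1 M"
    and opt: "\<And>i. i \<ge> 1 \<Longrightarrow>
      optimal_decision M st (i, k, l) (if i < N then Collaborative else Independent)"
  shows "\<exists>\<pi>. optimal_policy M \<pi> \<and> collaborative_threshold M \<pi> st l N"
proof -
  have "\<exists>a. optimal_decision M st' s a" for st' s
    by (metis optimal_decision_def min_def)
  then obtain best where best: "\<And>st' s. optimal_decision M st' s (best st' s)" by metis
  define \<pi> where "\<pi> st' s = (case s of (i, k', l') \<Rightarrow>
    if st' = st \<and> l' = l then (if i < N then Collaborative else Independent) else best st' s)" for st' s
  have "optimal_policy M \<pi>"
    unfolding optimal_policy_def
  proof (intro ballI allI impI)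
    fix s st' assume s: "s \<in> decision_states M"
    obtain i k' l' where e: "s = (i, k', l')" by (cases s)
    have "i \<ge> 1" "k' + l' = C\<^sub>1 M" using s by (auto simp: e decision_states_def state_space_def)
    moreover from this have "k' = k" if "l' = l" using assms(1) that by simp
    ultimately show "optimal_decision M st' s (\<pi> st' s)"
      using opt[of i] best by (auto simp: e \<pi>_def)
  qed
  moreover have "collaborative_threshold M \<pi> st l N"
    by (simp add: collaborative_threshold_def \<pi>_def)
  ultimately show ?thesis by blast
qed

text \<open>
  The number of initial \<open>i\<close> with positive gain, if the gain is nonincreasing in \<open>i\<close>. The queue length seen by
  the decision maker exceeds the queue length after the decision by one, which shifts the threshold.
\<close>

definition threshold :: "nat \<Rightarrow> nat" where
  "threshold m = (LEAST i. gain i m \<le> 0)"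

lemma optimal_policy_threshold:
  assumes "k + l = C\<^sub>1 M" "slows m"
    and "st = Station1 \<and> k \<ge> 1 \<and> m = l \<or> st = Station2 \<and> l \<ge> 1 \<and> m = l - 1"
  shows "\<exists>\<pi>. optimal_policy M \<pi> \<and> collaborative_threshold M \<pi> st l (threshold m + 1)"
proof (rule optimal_threshold_policy[OF assms(1)])
  fix i :: nat assume i: "i \<ge> 1"
  have "gain (threshold m) m \<le> 0"
    unfolding threshold_def using eventually_gain_nonpos[OF assms(2)] by (rule LeastI_ex)
  then have "gain (i - 1) m \<le> 0" if "\<not> i < threshold m + 1"
    using gain_antimono[OF assms(2), of "threshold m" "i - 1"] that by linarith
  moreover have "gain (i - 1) m \<ge> 0" if "i < threshold m + 1"
  proof -
    have "i - 1 < threshold m" using that i by simp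
    then show ?thesis unfolding threshold_def by (auto dest: not_less_Least)
  qed
  ultimately show "optimal_decision M st (i, k, l)
      (if i < threshold m + 1 then Collaborative else Independent)"
    using optimal_decision_gain[OF assms(1) i assms(3)] by simp
qed

lemma optimal_independent:
  assumes "k + l = C\<^sub>1 M" "slows m" "i \<ge> 1"
    and "st = Station1 \<and> k \<ge> 1 \<and> m = l \<or> st = Station2 \<and> l \<ge> 1 \<and> m = l - 1"
    and le: "h\<^sub>1 M / \<mu>\<^sub>1 M \<le> (real m + 1) / real (C\<^sub>2 M) * (h\<^sub>2 M / \<mu>\<^sub>2 M)"
  shows "optimal_decision M st (i, k, l) Independent"
proof -
  have "h\<^sub>1 M / \<mu>\<^sub>1 M \<le> drain_cost (Suc m)"
  proof (cases "Suc m \<le> C\<^sub>2 M")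
    case True
    \<comment> \<open>As \<open>index_order\<close> is the reverse of the bound derived here, this case is only possible if the two
      ratios \<open>h\<^sub>1 / \<mu>\<^sub>1\<close> and \<open>h\<^sub>2 / \<mu>\<^sub>2\<close> coincide.\<close>
    have "(real m + 1) / real (C\<^sub>2 M) * (h\<^sub>2 M / \<mu>\<^sub>2 M) \<le> 1 * (h\<^sub>2 M / \<mu>\<^sub>2 M)"
      using True servers costs rates by (intro mult_right_mono) auto
    with le True show ?thesis by (simp add: drain_cost_below_C2)
  next
    case False
    with le show ?thesis by (simp add: drain_cost_above_C2 add.commute)
  qed
  then have "gain 0 m \<le> 0" using assms(2) by (simp add: gain_0 slows_def)
  then have "gain (i - 1) m \<le> 0" using gain_antimono[OF assms(2), of 0 "i - 1"] by simp
  then show ?thesis using optimal_decision_gain(2)[OF assms(1,3,4)] by simp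
qed

lemma optimal_collaborative:
  assumes "k + l = C\<^sub>1 M" "i \<ge> 1" "\<mu>\<^sub>1 M \<le> \<mu>\<^sub>2 M" "m < C\<^sub>2 M"
    and "st = Station1 \<and> k \<ge> 1 \<and> m = l \<or> st = Station2 \<and> l \<ge> 1 \<and> m = l - 1"
  shows "optimal_decision M st (i, k, l) Collaborative"
  using optimal_decision_gain(1)[OF assms(1,2,5)] gain_nonneg costs index_order assms(3,4) by blast

end

theorem theorem3p1:
  fixes M :: station_model
  assumes "1 \<le> C\<^sub>2 M" and "C\<^sub>2 M < C\<^sub>1 M"
    and "\<mu>\<^sub>1 M > 0" and "\<mu>\<^sub>2 M > 0"
    and "h\<^sub>0 M > 0" and "h\<^sub>1 M > 0" and "h\<^sub>2 M > 0"
    and "h\<^sub>1 M / \<mu>\<^sub>1 M \<ge> h\<^sub>2 M / \<mu>\<^sub>2 M"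
  shows
    "(\<mu>\<^sub>1 M \<le> \<mu>\<^sub>2 M \<longrightarrow>
       (\<exists>N\<^sub>2 :: nat \<Rightarrow> nat. \<forall>k l. k + l = C\<^sub>1 M \<longrightarrow>
         (k \<ge> 1 \<longrightarrow>
           (l < C\<^sub>2 M \<longrightarrow> (\<forall>i\<ge>1. optimal_decision M Station1 (i, k, l) Collaborative)) \<and>
           (l \<ge> C\<^sub>2 M \<longrightarrow>
             (\<exists>\<pi>. optimal_policy M \<pi> \<and> collaborative_threshold M \<pi> Station1 l (N\<^sub>2 l + 1))) \<and>
           (l \<ge> C\<^sub>2 M \<and> h\<^sub>1 M / \<mu>\<^sub>1 M \<le> (real l + 1) / real (C\<^sub>2 M) * (h\<^sub>2 M / \<mu>\<^sub>2 M) \<longrightarrow>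
             (\<forall>i\<ge>1. optimal_decision M Station1 (i, k, l) Independent))) \<and>
         (l \<ge> 1 \<longrightarrow>
           (l \<le> C\<^sub>2 M \<longrightarrow> (\<forall>i\<ge>1. optimal_decision M Station2 (i, k, l) Collaborative)) \<and>
           (l > C\<^sub>2 M \<longrightarrow>
             (\<exists>\<pi>. optimal_policy M \<pi> \<and> collaborative_threshold M \<pi> Station2 l (N\<^sub>2 (l - 1) + 1))) \<and>
           (l > C\<^sub>2 M \<and> h\<^sub>1 M / \<mu>\<^sub>1 M \<le> real l / real (C\<^sub>2 M) * (h\<^sub>2 M / \<mu>\<^sub>2 M) \<longrightarrow>
             (\<forall>i\<ge>1. optimal_decision M Station2 (i, k, l) Independent))))) \<and>
     (\<mu>\<^sub>1 M > \<mu>\<^sub>2 M \<longrightarrow>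
       (\<exists>N\<^sub>1 :: nat \<Rightarrow> nat. \<forall>k l. k + l = C\<^sub>1 M \<longrightarrow>
         (k \<ge> 1 \<longrightarrow>
           (\<exists>\<pi>. optimal_policy M \<pi> \<and> collaborative_threshold M \<pi> Station1 l (N\<^sub>1 l + 1)) \<and>
           (h\<^sub>1 M / \<mu>\<^sub>1 M \<le> (real l + 1) / real (C\<^sub>2 M) * (h\<^sub>2 M / \<mu>\<^sub>2 M) \<longrightarrow>
             (\<forall>i\<ge>1. optimal_decision M Station1 (i, k, l) Independent))) \<and>
         (l \<ge> 1 \<longrightarrow>
           (\<exists>\<pi>. optimal_policy M \<pi> \<and> collaborative_threshold M \<pi> Station2 l (N\<^sub>1 (l - 1) + 1)) \<and>
           (h\<^sub>1 M / \<mu>\<^sub>1 M \<le> real l / real (C\<^sub>2 M) * (h\<^sub>2 M / \<mu>\<^sub>2 M) \<longrightarrow>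
             (\<forall>i\<ge>1. optimal_decision M Station2 (i, k, l) Independent)))))"
proof -
  interpret cost_system M using assms by unfold_locales
  have s1: "slows l" if "k + l = C\<^sub>1 M" "k \<ge> 1" "C\<^sub>2 M \<le> l \<or> \<mu>\<^sub>2 M < \<mu>\<^sub>1 M" for k l
    using that by (auto simp: slows_def)
  have s2: "slows (l - 1)" if "k + l = C\<^sub>1 M" "l \<ge> 1" "C\<^sub>2 M < l \<or> \<mu>\<^sub>2 M < \<mu>\<^sub>1 M" for k l
    using that by (auto simp: slows_def)
  have e: "real (l - 1) + 1 = real l" if "l \<ge> 1" for l :: nat
    using that by simp
  have c1: "optimal_decision M Station1 (i, k, l) Collaborative"
    if "\<mu>\<^sub>1 M \<le> \<mu>\<^sub>2 M" "k + l = C\<^sub>1 M" "k \<ge> 1" "l < C\<^sub>2 M" "i \<ge> 1" for i k l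
    using that by (intro optimal_collaborative[where m = l]) auto
  have c2: "optimal_decision M Station2 (i, k, l) Collaborative"
    if "\<mu>\<^sub>1 M \<le> \<mu>\<^sub>2 M" "k + l = C\<^sub>1 M" "l \<ge> 1" "l \<le> C\<^sub>2 M" "i \<ge> 1" for i k l
    using that by (intro optimal_collaborative[where m = "l - 1"]) auto
  have t1: "\<exists>\<pi>. optimal_policy M \<pi> \<and> collaborative_threshold M \<pi> Station1 l (threshold l + 1)"
    if "k + l = C\<^sub>1 M" "k \<ge> 1" "C\<^sub>2 M \<le> l \<or> \<mu>\<^sub>2 M < \<mu>\<^sub>1 M" for k l
    using optimal_policy_threshold[OF that(1) s1[OF that]] that by blast
  have t2: "\<exists>\<pi>. optimal_policy M \<pi> \<and> collaborative_threshold M \<pi> Station2 l (threshold (l - 1) + 1)"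
    if "k + l = C\<^sub>1 M" "l \<ge> 1" "C\<^sub>2 M < l \<or> \<mu>\<^sub>2 M < \<mu>\<^sub>1 M" for k l
    using optimal_policy_threshold[OF that(1) s2[OF that]] that by blast
  have i1: "optimal_decision M Station1 (i, k, l) Independent"
    if "k + l = C\<^sub>1 M" "k \<ge> 1" "C\<^sub>2 M \<le> l \<or> \<mu>\<^sub>2 M < \<mu>\<^sub>1 M" "i \<ge> 1"
      "h\<^sub>1 M / \<mu>\<^sub>1 M \<le> (real l + 1) / real (C\<^sub>2 M) * (h\<^sub>2 M / \<mu>\<^sub>2 M)" for i k l
    using optimal_independent[OF that(1) s1[OF that(1-3)] that(4) _ that(5)] that(2) by blast
  have i2: "optimal_decision M Station2 (i, k, l) Independent"
    if "k + l = C\<^sub>1 M" "l \<ge> 1" "C\<^sub>2 M < l \<or> \<mu>\<^sub>2 M < \<mu>\<^sub>1 M" "i \<ge> 1"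
      "h\<^sub>1 M / \<mu>\<^sub>1 M \<le> real l / real (C\<^sub>2 M) * (h\<^sub>2 M / \<mu>\<^sub>2 M)" for i k l
    using optimal_independent[OF that(1) s2[OF that(1-3)] that(4)] that(2,5) e[OF that(2)]
    by presburger
  show ?thesis
    by (intro conjI impI exI[of _ threshold] allI) (blast intro: c1 c2 t1 t2 i1 i2)+
qed

end
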